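(* Let $m\ge 6$ be an even integer. (a) There exist vectors $v_1,\ldots,v_m\in S^2$ which minimize the function $$P(w_1,\ldots,w_m)=\sum_{1\le i,j\le m}\langle w_i,w_j\rangle_{\mathbb R}^2$$ over all $(w_1,\ldots,w_m)\in (S^2)^m$ and which in addition satisfy $$\sum_{1\le i,j\le m}\langle v_i,v_j\rangle_{\mathbb R}=\sum_{1\le i,j\le m}\langle v_i,v_j\rangle_{\mathbb R}^3=0.$$ (b) $$M^6(m,2)=\frac{m(m-4)}{8}.$$
   Context: $S^2$ is the unit sphere in $\mathbb R^3$ and $\langle\cdot,\cdot\rangle_{\mathbb R}$ is the standard real inner product. The minimum in (a) is the minimum over all of $(S^2)^m$ (not only over tuples satisfying the additional conditions). On $\mathbb C^n$ use the standard Hermitian inner product $\langle v,w\rangle=\sum_{i} v_i\overline{w_i}$ and norm $\|v\|=\langle v,v\rangle^{1/2}$. For positive integers $m,n,p$, $$M^p(m,n)=\min\Big\{\sum_{1\le i<j\le m}|\langle v_i,v_j\rangle|^p \;:\; v_1,\ldots,v_m\in\mathbb C^n,\ \|v_l\|=1 \text{ for all } 1\le l\le m\Big\}.$$ *)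

theory Defs
  imports "HOL-Analysis.Analysis"
begin

definition herm_inner :: "complex ^ 'n \<Rightarrow> complex ^ 'n \<Rightarrow> complex"
  where "herm_inner v w = (\<Sum>i\<in>UNIV. v $ i * cnj (w $ i))"

text \<open>The library norm on \<open>complex ^ 'n\<close> is the one induced by \<open>herm_inner\<close>.\<close>

lemma herm_inner_self: "herm_inner v v = complex_of_real ((norm v)\<^sup>2)"
proof -
  have "complex_of_real ((norm v)\<^sup>2) = (\<Sum>i\<in>UNIV. complex_of_real ((cmod (v $ i))\<^sup>2))"
    unfolding norm_vec_def L2_set_def by (simp add: sum_nonneg)
  then show ?thesis
    unfolding herm_inner_def by (simp only: complex_norm_square)
qed

text \<open>An \<open>m\<close>-tuple is a function on \<open>nat\<close>, of which only the values on \<open>{1..m}\<close> matter.\<close>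

definition frame_potential :: "nat \<Rightarrow> nat \<Rightarrow> (nat \<Rightarrow> complex ^ 'n) \<Rightarrow> real"
  where "frame_potential p m v = (\<Sum>i\<in>{1..m}. \<Sum>j\<in>{i<..m}. cmod (herm_inner (v i) (v j)) ^ p)"

text \<open>The dimension \<open>n\<close> is the cardinality of the index type \<open>'n\<close>. \<open>Least\<close> on \<open>real\<close> is
  meaningful only if a minimum exists; \<open>min_potential_attained\<close> shows that it does.\<close>

definition min_potential :: "nat \<Rightarrow> nat \<Rightarrow> 'n::finite itself \<Rightarrow> real"
  where "min_potential p m _ =
    (LEAST x. \<exists>v :: nat \<Rightarrow> complex ^ 'n. (\<forall>l\<in>{1..m}. norm (v l) = 1) \<and> x = frame_potential p m v)"

lemma frame_potential_has_min:
  "\<exists>v :: nat \<Rightarrow> complex ^ 'n. (\<forall>l\<in>{1..m}. norm (v l) = 1) \<and>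
     (\<forall>w :: nat \<Rightarrow> complex ^ 'n. (\<forall>l\<in>{1..m}. norm (w l) = 1) \<longrightarrow> frame_potential p m v \<le> frame_potential p m w)"
proof -
  define S :: "(nat \<Rightarrow> complex ^ 'n) set" where "S = PiE UNIV (\<lambda>_. sphere 0 1)"
  obtain e :: "complex ^ 'n" where e: "norm e = 1"
    using vector_choose_size[of 1] by auto
  have "compactin (product_topology (\<lambda>_. euclidean) UNIV) S"
    unfolding S_def compactin_PiE by simp
  then have "compact S"
    by (simp add: euclidean_product_topology)
  moreover have "S \<noteq> {}"
    using e by (auto simp: S_def PiE_eq_empty_iff)
  moreover have "continuous_on S (frame_potential p m)"
    unfolding frame_potential_def herm_inner_def
    by (intro continuous_intros continuous_on_product_coordinates continuous_on_subset[OF continuous_on_product_coordinates]) auto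
  ultimately obtain v where v: "v \<in> S" "\<And>w. w \<in> S \<Longrightarrow> frame_potential p m v \<le> frame_potential p m w"
    using continuous_attains_inf by metis
  have "frame_potential p m v \<le> frame_potential p m w" if w: "\<forall>l\<in>{1..m}. norm (w l) = 1" for w :: "nat \<Rightarrow> complex ^ 'n"
  proof -
    define u where "u l = (if l \<in> {1..m} then w l else e)" for l
    have "u \<in> S"
      using w e by (auto simp: u_def S_def)
    moreover have "frame_potential p m u = frame_potential p m w"
      unfolding frame_potential_def by (intro sum.cong) (auto simp: u_def)
    ultimately show ?thesis
      using v(2) by metis
  qed
  moreover have "norm (v l) = 1" for l
    using v(1) by (auto simp: S_def)
  ultimately show ?thesis
    by blast
qed

lemma min_potential_attained:
  "\<exists>v :: nat \<Rightarrow> complex ^ 'n. (\<forall>l\<in>{1..m}. norm (v l) = 1) \<and>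
     min_potential p m TYPE('n) = frame_potential p m v \<and>
     (\<forall>w :: nat \<Rightarrow> complex ^ 'n. (\<forall>l\<in>{1..m}. norm (w l) = 1) \<longrightarrow> frame_potential p m v \<le> frame_potential p m w)"
proof -
  obtain v :: "nat \<Rightarrow> complex ^ 'n" where v: "\<forall>l\<in>{1..m}. norm (v l) = 1"
    "\<forall>w :: nat \<Rightarrow> complex ^ 'n. (\<forall>l\<in>{1..m}. norm (w l) = 1) \<longrightarrow> frame_potential p m v \<le> frame_potential p m w"
    using frame_potential_has_min by blast
  have "min_potential p m TYPE('n) = frame_potential p m v"
    unfolding min_potential_def by (rule Least_equality) (use v in blast)+
  then show ?thesis
    using v by blast
qed

end

theory Submission
  imports Defs
begin

text \<open>
  Both parts come from moments of points on the sphere. Writing \<open>S\<^sub>p\<close> for the sum of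
  \<open>(x\<^sub>i \<bullet> x\<^sub>j)\<^sup>p\<close> over all pairs \<open>(i, j)\<close>, the numbers \<open>S\<^sub>p\<close> are
  squared norms of the moment tensors \<open>\<Sum>\<^sub>i x\<^sub>i \<otimes> \<dots> \<otimes> x\<^sub>i\<close>. Hence
  \<open>S\<^sub>1 \<ge> 0\<close> and \<open>S\<^sub>3 \<ge> 0\<close>, while for unit vectors the second moment tensor is a matrix of
  trace \<open>m\<close>, so that \<open>S\<^sub>2 \<ge> m\<^sup>2 / 3\<close> (lemma \<open>welch_bound\<close>). All three bounds are equalities
  at once for a configuration \<open>\<plusminus>u\<^sub>1, \<dots>, \<plusminus>u\<^sub>k\<close> with \<open>m = 2 k\<close>, where \<open>u\<^sub>1, \<dots>, u\<^sub>k\<close> is a tight frame of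
  unit vectors: the sign symmetry annihilates the odd moments, and tightness makes the second
  moment scalar. A tight frame exists for every \<open>k \<ge> 3\<close>: a regular \<open>k\<close>-gon drawn on the circle of
  latitude at height \<open>1 / sqrt 3\<close> (lemma \<open>harmonic_frame_tight\<close>).
  This proves (a).

  For (b), the Hopf map sends a unit vector \<open>v\<close> of \<open>\<complex>\<^sup>2\<close> to a point \<open>h v\<close> of the sphere with
  \<open>\<bar>\<langle>v, w\<rangle>\<bar>\<^sup>2 = (1 + h v \<bullet> h w) / 2\<close>, and it is onto. Taking cubes turns the potential with exponent
  6 into an affine function of \<open>S\<^sub>1\<close>, \<open>S\<^sub>2\<close>, \<open>S\<^sub>3\<close> with positive coefficients
  (lemma \<open>frame_potential_6_hopf\<close>), so the three bounds give the lower bound and lifting the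
  configuration from (a) attains it.
\<close>

section \<open>Moment bounds for vectors in Euclidean space\<close>

lemma sum_inner_nonneg:
  fixes x :: "'i \<Rightarrow> 'a::real_inner"
  shows "0 \<le> (\<Sum>i\<in>A. \<Sum>j\<in>A. x i \<bullet> x j)"
proof -
  have "(\<Sum>i\<in>A. \<Sum>j\<in>A. x i \<bullet> x j) = (\<Sum>i\<in>A. x i) \<bullet> (\<Sum>j\<in>A. x j)"
    by (simp add: inner_sum_left inner_sum_right) (rule sum.swap)
  then show ?thesis by simp
qed

text \<open>The double sum of squares is the squared Frobenius norm of the frame operator.\<close>

lemma sum_inner_power2_eq:
  fixes x :: "'i \<Rightarrow> real ^ 'n"
  shows "(\<Sum>i\<in>A. \<Sum>j\<in>A. (x i \<bullet> x j) ^ 2) = (\<Sum>a\<in>UNIV. \<Sum>b\<in>UNIV. (\<Sum>i\<in>A. x i $ a * x i $ b) ^ 2)"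
proof -
  have "(\<Sum>a\<in>UNIV. \<Sum>b\<in>UNIV. (\<Sum>i\<in>A. x i $ a * x i $ b) ^ 2)
      = (\<Sum>a\<in>UNIV. \<Sum>b\<in>UNIV. \<Sum>i\<in>A. \<Sum>j\<in>A. (x i $ a * x i $ b) * (x j $ a * x j $ b))"
    by (simp only: power2_eq_square sum_product)
  also have "\<dots> = (\<Sum>a\<in>UNIV. \<Sum>i\<in>A. \<Sum>b\<in>UNIV. \<Sum>j\<in>A. (x i $ a * x i $ b) * (x j $ a * x j $ b))"
    by (intro sum.cong refl sum.swap)
  also have "\<dots> = (\<Sum>i\<in>A. \<Sum>a\<in>UNIV. \<Sum>b\<in>UNIV. \<Sum>j\<in>A. (x i $ a * x i $ b) * (x j $ a * x j $ b))"
    by (rule sum.swap)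
  also have "\<dots> = (\<Sum>i\<in>A. \<Sum>a\<in>UNIV. \<Sum>j\<in>A. \<Sum>b\<in>UNIV. (x i $ a * x i $ b) * (x j $ a * x j $ b))"
    by (intro sum.cong refl sum.swap)
  also have "\<dots> = (\<Sum>i\<in>A. \<Sum>j\<in>A. \<Sum>a\<in>UNIV. \<Sum>b\<in>UNIV. (x i $ a * x i $ b) * (x j $ a * x j $ b))"
    by (intro sum.cong refl sum.swap)
  also have "\<dots> = (\<Sum>i\<in>A. \<Sum>j\<in>A. (x i \<bullet> x j) ^ 2)"
    by (simp add: inner_vec_def power2_eq_square sum_product mult_ac)
  finally show ?thesis by simp
qed

text \<open>
  Cubes reduce to a lower moment: \<open>(x\<^sub>i \<bullet> x\<^sub>j)\<^sup>3\<close> is a sum over two coordinates of inner products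
  of the rescaled vectors \<open>(x\<^sub>i)\<^sub>a (x\<^sub>i)\<^sub>b x\<^sub>i\<close>.
\<close>

lemma sum_inner_power3_nonneg:
  fixes x :: "'i \<Rightarrow> real ^ 'n"
  shows "0 \<le> (\<Sum>i\<in>A. \<Sum>j\<in>A. (x i \<bullet> x j) ^ 3)"
proof -
  define y where "y a b i = (x i $ a * x i $ b) *\<^sub>R x i" for a b i
  have "(x i \<bullet> x j) ^ 3 = (\<Sum>a\<in>UNIV. \<Sum>b\<in>UNIV. y a b i \<bullet> y a b j)" for i j
  proof -
    have "(x i \<bullet> x j) ^ 3 = (\<Sum>a\<in>UNIV. x i $ a * x j $ a) * (\<Sum>b\<in>UNIV. x i $ b * x j $ b) * (x i \<bullet> x j)"
      by (simp add: inner_vec_def power3_eq_cube)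
    also have "\<dots> = (\<Sum>a\<in>UNIV. \<Sum>b\<in>UNIV. (x i $ a * x j $ a) * (x i $ b * x j $ b) * (x i \<bullet> x j))"
      by (subst sum_product) (simp only: sum_distrib_right)
    finally show ?thesis
      by (simp add: y_def mult_ac)
  qed
  then have "(\<Sum>i\<in>A. \<Sum>j\<in>A. (x i \<bullet> x j) ^ 3) = (\<Sum>i\<in>A. \<Sum>j\<in>A. \<Sum>a\<in>UNIV. \<Sum>b\<in>UNIV. y a b i \<bullet> y a b j)"
    by simp
  also have "\<dots> = (\<Sum>i\<in>A. \<Sum>a\<in>UNIV. \<Sum>j\<in>A. \<Sum>b\<in>UNIV. y a b i \<bullet> y a b j)"
    by (intro sum.cong refl sum.swap)
  also have "\<dots> = (\<Sum>a\<in>UNIV. \<Sum>i\<in>A. \<Sum>j\<in>A. \<Sum>b\<in>UNIV. y a b i \<bullet> y a b j)"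
    by (rule sum.swap)
  also have "\<dots> = (\<Sum>a\<in>UNIV. \<Sum>i\<in>A. \<Sum>b\<in>UNIV. \<Sum>j\<in>A. y a b i \<bullet> y a b j)"
    by (intro sum.cong refl sum.swap)
  also have "\<dots> = (\<Sum>a\<in>UNIV. \<Sum>b\<in>UNIV. \<Sum>i\<in>A. \<Sum>j\<in>A. y a b i \<bullet> y a b j)"
    by (intro sum.cong refl sum.swap)
  finally show ?thesis
    by (simp add: sum_nonneg sum_inner_nonneg)
qed

text \<open>
  The trace of the frame operator is the number of vectors, and a symmetric matrix of given trace
  has the least Frobenius norm when it is scalar: drop the entries off the diagonal and apply the
  Cauchy-Schwarz inequality to the diagonal.
\<close>

lemma welch_bound:
  fixes x :: "'i \<Rightarrow> real ^ 'n"
  assumes "\<And>i. i \<in> A \<Longrightarrow> norm (x i) = 1"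
  shows "(real (card A))\<^sup>2 / real CARD('n) \<le> (\<Sum>i\<in>A. \<Sum>j\<in>A. (x i \<bullet> x j) ^ 2)"
proof -
  define d where "d a = (\<Sum>i\<in>A. x i $ a * x i $ a)" for a
  have "x i \<bullet> x i = 1" if "i \<in> A" for i
    using assms[OF that] by (simp add: norm_eq_1)
  then have "real (card A) = (\<Sum>i\<in>A. \<Sum>a\<in>UNIV. x i $ a * x i $ a)"
    by (simp add: inner_vec_def)
  then have trace: "real (card A) = (\<Sum>a\<in>UNIV. d a)"
    unfolding d_def by (simp add: sum.swap[of _ A])
  have "(\<Sum>a\<in>UNIV. d a)\<^sup>2 \<le> (\<Sum>a\<in>UNIV. (d a)\<^sup>2) * (\<Sum>a\<in>(UNIV::'n set). 1\<^sup>2)"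
    using Cauchy_Schwarz_ineq_sum[of d "\<lambda>_. 1" UNIV] by simp
  then have "(real (card A))\<^sup>2 / real CARD('n) \<le> (\<Sum>a\<in>UNIV. (d a)\<^sup>2)"
    unfolding trace by (simp add: field_simps)
  also have "\<dots> \<le> (\<Sum>a\<in>UNIV. \<Sum>b\<in>UNIV. (\<Sum>i\<in>A. x i $ a * x i $ b) ^ 2)"
    unfolding d_def
    by (intro sum_mono member_le_sum[where f = "\<lambda>b. (\<Sum>i\<in>A. x i $ a * x i $ b) ^ 2" for a]) auto
  finally show ?thesis
    by (simp only: sum_inner_power2_eq)
qed

section \<open>An antipodal tight frame\<close>

lemma sum_cis_eq_0:
  assumes "\<not> int k dvd l"
  shows "(\<Sum>j\<in>{1..k}. cis (2 * pi * real_of_int l * real j / real k)) = 0"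
proof (cases "k = 0")
  case False
  define z where "z = cis (2 * pi * real_of_int l / real k)"
  have pow: "cis (2 * pi * real_of_int l * real j / real k) = z ^ j" for j
    by (simp add: z_def Complex.DeMoivre mult_ac)
  have "z \<noteq> 1"
  proof
    assume "z = 1"
    then have "cos (2 * pi * real_of_int l / real k) = 1"
      unfolding z_def by (metis cis.sel(1) one_complex.sel(1))
    then obtain n where "2 * pi * real_of_int l / real k = real_of_int n * 2 * pi"
      by (auto simp: cos_one_2pi_int)
    then have "real_of_int l = real_of_int (n * int k)"
      using False by (simp add: field_simps)
    then have "l = n * int k"
      by (simp only: of_int_eq_iff)
    then show False
      using assms by simp
  qed
  moreover have "z ^ k = 1"
    using False by (simp add: z_def Complex.DeMoivre cis_multiple_2pi)
  ultimately have "(\<Sum>j<k. z ^ j) = 0"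
    by (simp add: geometric_sum)
  then have "z * (\<Sum>j<k. z ^ j) = 0"
    by simp
  then have "(\<Sum>j\<in>{1..k}. z ^ j) = 0"
    by (simp add: sum_distrib_left sum.atLeast1_atMost_eq)
  then show ?thesis
    by (simp only: pow)
qed simp

text \<open>
  The third coordinate has to be \<open>1 / sqrt 3\<close> for the third diagonal entry of the frame operator
  to be a third of the trace.
\<close>

definition harmonic_frame :: "nat \<Rightarrow> nat \<Rightarrow> real ^ 3" where
  "harmonic_frame k j =
    vector [sqrt (2/3) * cos (2 * pi * real j / real k),
            sqrt (2/3) * sin (2 * pi * real j / real k), sqrt (1/3)]"

lemma norm_harmonic_frame: "norm (harmonic_frame k j) = 1"
proof -
  define t where "t = 2 * pi * real j / real k"
  have "harmonic_frame k j = vector [sqrt (2/3) * cos t, sqrt (2/3) * sin t, sqrt (1/3)]"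
    by (simp only: harmonic_frame_def t_def)
  then have "harmonic_frame k j \<bullet> harmonic_frame k j = 2/3 * (cos t)\<^sup>2 + 2/3 * (sin t)\<^sup>2 + 1/3"
    by (simp add: inner_vec_def sum_3 power_mult_distrib flip: power2_eq_square)
  then show ?thesis
    by (simp add: norm_eq_1 cos_squared_eq field_simps)
qed

text \<open>
  Expanding the square by double-angle formulas leaves a constant term and terms of frequency one
  and two; the latter sum to zero because neither frequency is a multiple of \<open>k\<close>.
\<close>

lemma harmonic_frame_tight:
  assumes "k \<ge> 3"
  shows "(\<Sum>j\<in>{1..k}. (y \<bullet> harmonic_frame k j)\<^sup>2) = real k / 3 * (y \<bullet> y)"
proof -
  define t where "t j = 2 * pi * real j / real k" for j
  have "(\<Sum>j\<in>{1..k}. cis (t j)) = 0" "(\<Sum>j\<in>{1..k}. cis (2 * t j)) = 0"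
    using sum_cis_eq_0[of k 1] sum_cis_eq_0[of k 2] assms
    by (auto simp: t_def zdvd_not_zless mult_ac)
  then have zero: "(\<Sum>j\<in>{1..k}. cos (t j)) = 0" "(\<Sum>j\<in>{1..k}. sin (t j)) = 0"
    "(\<Sum>j\<in>{1..k}. cos (2 * t j)) = 0" "(\<Sum>j\<in>{1..k}. sin (2 * t j)) = 0"
    by (simp_all add: complex_eq_iff)
  define a b c where "a = y $ 1" and "b = y $ 2" and "c = y $ 3"
  define r where "r = 2 * sqrt (2/3) * sqrt (1/3) * c"
  have "(y \<bullet> harmonic_frame k j)\<^sup>2 =
      (a\<^sup>2 + b\<^sup>2 + c\<^sup>2) / 3 + r * a * cos (t j) + r * b * sin (t j)
        + (a\<^sup>2 - b\<^sup>2) / 3 * cos (2 * t j) + 2 * a * b / 3 * sin (2 * t j)" for j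
  proof -
    have "harmonic_frame k j = vector [sqrt (2/3) * cos (t j), sqrt (2/3) * sin (t j), sqrt (1/3)]"
      by (simp only: harmonic_frame_def t_def)
    then have "y \<bullet> harmonic_frame k j = sqrt (2/3) * (a * cos (t j) + b * sin (t j)) + sqrt (1/3) * c"
      by (simp add: inner_vec_def sum_3 a_def b_def c_def algebra_simps)
    then have eq: "(y \<bullet> harmonic_frame k j)\<^sup>2 =
        2/3 * (a * cos (t j) + b * sin (t j))\<^sup>2 + c\<^sup>2 / 3 + r * (a * cos (t j) + b * sin (t j))"
      by (simp add: power2_sum power_mult_distrib r_def real_sqrt_divide power_divide)
    have squares: "(sin (t j))\<^sup>2 = (1 - cos (2 * t j)) / 2" "(cos (t j))\<^sup>2 = (1 + cos (2 * t j)) / 2"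
      using cos_double_sin[of "t j"] cos_double_cos[of "t j"] by simp_all
    have product: "sin (t j) * cos (t j) = sin (2 * t j) / 2"
      by (simp add: sin_double)
    have expand: "(a * cos (t j) + b * sin (t j))\<^sup>2 =
        a\<^sup>2 * (cos (t j))\<^sup>2 + b\<^sup>2 * (sin (t j))\<^sup>2 + 2 * a * b * (sin (t j) * cos (t j))"
      by (simp add: power2_eq_square algebra_simps)
    show ?thesis
      unfolding eq expand squares product by (simp add: field_simps)
  qed
  then have "(\<Sum>j\<in>{1..k}. (y \<bullet> harmonic_frame k j)\<^sup>2) =
      (\<Sum>j\<in>{1..k}. (a\<^sup>2 + b\<^sup>2 + c\<^sup>2) / 3) + r * a * (\<Sum>j\<in>{1..k}. cos (t j)) + r * b * (\<Sum>j\<in>{1..k}. sin (t j))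
        + (a\<^sup>2 - b\<^sup>2) / 3 * (\<Sum>j\<in>{1..k}. cos (2 * t j)) + 2 * a * b / 3 * (\<Sum>j\<in>{1..k}. sin (2 * t j))"
    by (simp only: sum.distrib sum_distrib_left)
  then show ?thesis
    unfolding zero by (simp add: inner_vec_def sum_3 a_def b_def c_def power2_eq_square)
qed

definition antipodal :: "nat \<Rightarrow> (nat \<Rightarrow> 'a) \<Rightarrow> nat \<Rightarrow> 'a::uminus" where
  "antipodal k u i = (if i \<le> k then u i else - u (i - k))"

lemma sum_antipodal:
  fixes f :: "'a::uminus \<Rightarrow> 'b::comm_monoid_add"
  shows "(\<Sum>i\<in>{1..2 * k}. f (antipodal k u i)) = (\<Sum>j\<in>{1..k}. f (u j) + f (- u j))"
proof -
  have "(\<Sum>i\<in>{1..k + k}. f (antipodal k u i)) =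
      (\<Sum>i\<in>{1..k}. f (antipodal k u i)) + (\<Sum>i\<in>{k+1..k+k}. f (antipodal k u i))"
    by (rule sum.ub_add_nat) simp
  also have "(\<Sum>i\<in>{k+1..k+k}. f (antipodal k u i)) = (\<Sum>j\<in>{1..k}. f (antipodal k u (j + k)))"
    using sum.shift_bounds_cl_nat_ivl[of "\<lambda>i. f (antipodal k u i)" 1 k k] by (simp add: add_ac)
  also have "\<dots> = (\<Sum>j\<in>{1..k}. f (- u j))"
    by (intro sum.cong) (auto simp: antipodal_def)
  also have "(\<Sum>i\<in>{1..k}. f (antipodal k u i)) = (\<Sum>j\<in>{1..k}. f (u j))"
    by (intro sum.cong) (auto simp: antipodal_def)
  finally show ?thesis
    by (simp add: sum.distrib mult_2)
qed

text \<open>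
  Already the sum over \<open>j\<close> alone does not depend on \<open>i\<close>: opposite points cancel in the odd powers,
  and tightness applied to \<open>v i\<close> gives \<open>m / 3\<close> for the squares.
\<close>

lemma exists_extremal_configuration:
  assumes "m \<ge> 6" "even m"
  obtains v :: "nat \<Rightarrow> real ^ 3" where
    "\<And>i. norm (v i) = 1"
    "(\<Sum>i\<in>{1..m}. \<Sum>j\<in>{1..m}. v i \<bullet> v j) = 0"
    "(\<Sum>i\<in>{1..m}. \<Sum>j\<in>{1..m}. (v i \<bullet> v j) ^ 2) = (real m)\<^sup>2 / 3"
    "(\<Sum>i\<in>{1..m}. \<Sum>j\<in>{1..m}. (v i \<bullet> v j) ^ 3) = 0"
proof -
  obtain k where m: "m = 2 * k"
    using assms(2) by (auto elim: evenE)
  have k: "k \<ge> 3"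
    using assms(1) m by simp
  define v where "v = antipodal k (harmonic_frame k)"
  have norm_v: "norm (v i) = 1" for i
    by (simp add: v_def antipodal_def norm_harmonic_frame)
  have "(\<Sum>j\<in>{1..m}. y \<bullet> v j) = 0" for y
    using sum_antipodal[of "\<lambda>x. y \<bullet> x" k "harmonic_frame k"] by (simp add: m v_def)
  moreover have "(\<Sum>j\<in>{1..m}. (y \<bullet> v j) ^ 3) = 0" for y
    using sum_antipodal[of "\<lambda>x. (y \<bullet> x) ^ 3" k "harmonic_frame k"]
    by (simp add: m v_def)
  moreover have row: "(\<Sum>j\<in>{1..m}. (v i \<bullet> v j) ^ 2) = real m / 3" for i
  proof -
    have "v i \<bullet> v i = 1"
      using norm_v by (simp add: norm_eq_1)
    then show ?thesis
      using sum_antipodal[of "\<lambda>x. (v i \<bullet> x) ^ 2" k "harmonic_frame k"] harmonic_frame_tight[OF k, of "v i"]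
      by (simp add: m flip: v_def sum_distrib_left)
  qed
  have "(\<Sum>i\<in>{1..m}. \<Sum>j\<in>{1..m}. (v i \<bullet> v j) ^ 2) = (real m)\<^sup>2 / 3"
    unfolding row by (simp add: power2_eq_square)
  ultimately show ?thesis
    using norm_v by (intro that[of v]) simp_all
qed

section \<open>The Hopf map\<close>

definition hopf :: "complex ^ 2 \<Rightarrow> real ^ 3" where
  "hopf v = vector [2 * Re (v $ 1 * cnj (v $ 2)), 2 * Im (v $ 1 * cnj (v $ 2)),
                    (cmod (v $ 1))\<^sup>2 - (cmod (v $ 2))\<^sup>2]"

lemma norm_sq_complex2: "(norm v)\<^sup>2 = (cmod (v $ 1))\<^sup>2 + (cmod (v $ 2))\<^sup>2" for v :: "complex ^ 2"
  by (simp add: norm_vec_def L2_set_def sum_2)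

lemma norm_sq_herm_inner_hopf:
  "(cmod (herm_inner v w))\<^sup>2 = ((norm v)\<^sup>2 * (norm w)\<^sup>2 + hopf v \<bullet> hopf w) / 2"
proof -
  have "2 * (cmod (herm_inner v w))\<^sup>2 = (norm v)\<^sup>2 * (norm w)\<^sup>2 + hopf v \<bullet> hopf w"
    unfolding norm_sq_complex2 herm_inner_def hopf_def inner_vec_def sum_2 sum_3 cmod_power2
    by simp algebra
  then show ?thesis
    by simp
qed

text \<open>Put \<open>w = v\<close> in the previous identity.\<close>

lemma norm_hopf: "norm (hopf v) = (norm v)\<^sup>2"
proof -
  have "cmod (herm_inner v v) = (norm v)\<^sup>2"
    by (simp add: herm_inner_self norm_power)
  then have "(norm (hopf v))\<^sup>2 = ((norm v)\<^sup>2)\<^sup>2"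
    using norm_sq_herm_inner_hopf[of v v] by (simp add: dot_square_norm power2_eq_square[of "(norm v)\<^sup>2"])
  then show ?thesis
    by (subst (asm) power2_eq_iff_nonneg) auto
qed

lemma hopf_surj:
  assumes "norm x = 1"
  obtains v where "norm v = 1" "hopf v = x"
proof -
  have x: "(x $ 1)\<^sup>2 + (x $ 2)\<^sup>2 + (x $ 3)\<^sup>2 = 1"
    using assms by (simp add: norm_eq_1 inner_vec_def sum_3 power2_eq_square)
  then have "(x $ 3)\<^sup>2 \<le> 1"
    using zero_le_power2[of "x $ 1"] zero_le_power2[of "x $ 2"] by linarith
  then have ge: "-1 \<le> x $ 3"
    by (simp add: abs_square_le_1)
  have "\<exists>v. hopf v = x"
  proof (cases "x $ 3 = -1")
    \<comment> \<open>The south pole is the one point whose preimages have no nonzero first coordinate.\<close>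
    case True
    then have "x $ 1 = 0" "x $ 2 = 0"
      using x by (simp_all add: sum_power2_eq_zero_iff)
    with True have "hopf (vector [0, 1]) = x"
      by (simp add: hopf_def vec_eq_iff forall_3)
    then show ?thesis ..
  next
    case False
    \<comment> \<open>A preimage is determined up to a phase; choose the one whose first coordinate is positive.\<close>
    define s where "s = sqrt ((1 + x $ 3) / 2)"
    have s: "s > 0" "s\<^sup>2 = (1 + x $ 3) / 2"
      using ge False by (simp_all add: s_def)
    define v :: "complex ^ 2" where
      "v = vector [complex_of_real s, Complex (x $ 1 / (2 * s)) (- x $ 2 / (2 * s))]"
    have "(x $ 1)\<^sup>2 + (x $ 2)\<^sup>2 = (1 + x $ 3) * (1 - x $ 3)"
      using x by (simp add: algebra_simps power2_eq_square)
    then have "((x $ 1)\<^sup>2 + (x $ 2)\<^sup>2) / (4 * s\<^sup>2) = (1 - x $ 3) / 2"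
      using ge False by (simp add: s(2) field_simps)
    then have "(x $ 1 / (2 * s))\<^sup>2 + (- x $ 2 / (2 * s))\<^sup>2 = (1 - x $ 3) / 2"
      by (simp add: power_divide power_mult_distrib add_divide_distrib)
    then have "hopf v = x"
      using s(1) by (simp add: hopf_def v_def vec_eq_iff forall_3 cmod_power2 s(2) field_simps)
    then show ?thesis ..
  qed
  then obtain v where v: "hopf v = x" ..
  then have "(norm v)\<^sup>2 = 1\<^sup>2"
    using assms norm_hopf[of v] by simp
  then have "norm v = 1"
    by (subst (asm) power2_eq_iff_nonneg) auto
  with v show ?thesis
    using that by blast
qed

section \<open>The potential of exponent six\<close>

lemma sum_symmetric_square:
  fixes f :: "nat \<Rightarrow> nat \<Rightarrow> 'a::comm_semiring_1"
  assumes "\<And>i j. f i j = f j i"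
  shows "(\<Sum>i\<in>{1..m}. \<Sum>j\<in>{1..m}. f i j) = (\<Sum>i\<in>{1..m}. f i i) + 2 * (\<Sum>i\<in>{1..m}. \<Sum>j\<in>{i<..m}. f i j)"
proof (induction m)
  case (Suc m)
  have "(\<Sum>j\<in>{i<..Suc m}. f i j) = (\<Sum>j\<in>{i<..m}. f i j) + f i (Suc m)" if "i \<in> {1..m}" for i
  proof -
    have "{i<..Suc m} = insert (Suc m) {i<..m}"
      using that by auto
    then show ?thesis
      by (simp add: add.commute)
  qed
  then have "(\<Sum>i\<in>{1..Suc m}. \<Sum>j\<in>{i<..Suc m}. f i j) =
      (\<Sum>i\<in>{1..m}. \<Sum>j\<in>{i<..m}. f i j) + (\<Sum>i\<in>{1..m}. f i (Suc m))"
    by (simp add: sum.distrib)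
  moreover have "(\<Sum>j\<in>{1..m}. f (Suc m) j) = (\<Sum>j\<in>{1..m}. f j (Suc m))"
    by (intro sum.cong refl assms)
  then have "(\<Sum>i\<in>{1..Suc m}. \<Sum>j\<in>{1..Suc m}. f i j) =
      (\<Sum>i\<in>{1..m}. \<Sum>j\<in>{1..m}. f i j) + 2 * (\<Sum>i\<in>{1..m}. f i (Suc m)) + f (Suc m) (Suc m)"
    by (simp add: sum.distrib mult_2 add.assoc)
  ultimately show ?case
    using Suc.IH by (simp add: algebra_simps)
qed simp

text \<open>
  Cube \<open>\<bar>\<langle>v, w\<rangle>\<bar>\<^sup>2 = (1 + h v \<bullet> h w) / 2\<close> and sum over all pairs; passing to pairs \<open>i < j\<close>
  removes the \<open>m\<close> diagonal terms, each equal to 1, and halves the rest.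
\<close>

lemma frame_potential_6_hopf:
  assumes "\<forall>i\<in>{1..m}. norm (v i) = 1"
  shows "frame_potential 6 m v =
    ((real m)\<^sup>2 - 8 * real m
      + 3 * (\<Sum>i\<in>{1..m}. \<Sum>j\<in>{1..m}. hopf (v i) \<bullet> hopf (v j))
      + 3 * (\<Sum>i\<in>{1..m}. \<Sum>j\<in>{1..m}. (hopf (v i) \<bullet> hopf (v j)) ^ 2)
      + (\<Sum>i\<in>{1..m}. \<Sum>j\<in>{1..m}. (hopf (v i) \<bullet> hopf (v j)) ^ 3)) / 16"
proof -
  define g where "g i j = hopf (v i) \<bullet> hopf (v j)" for i j
  define f where "f i j = cmod (herm_inner (v i) (v j)) ^ 6" for i j
  have f_cube: "f i j = (((norm (v i))\<^sup>2 * (norm (v j))\<^sup>2 + g i j) / 2) ^ 3" for i j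
    by (simp add: f_def g_def flip: norm_sq_herm_inner_hopf)
  have "f i j = f j i" for i j
    by (simp add: f_cube g_def inner_commute mult.commute)
  moreover have "f i i = 1" if "i \<in> {1..m}" for i
    using assms that by (simp add: f_def herm_inner_self)
  ultimately have "(\<Sum>i\<in>{1..m}. \<Sum>j\<in>{1..m}. f i j) = real m + 2 * frame_potential 6 m v"
    using sum_symmetric_square[of f m] by (simp add: frame_potential_def flip: f_def)
  moreover have "f i j = (1 + 3 * g i j + 3 * g i j ^ 2 + g i j ^ 3) / 8"
    if "i \<in> {1..m}" "j \<in> {1..m}" for i j
    using assms that by (simp add: f_cube power2_eq_square power3_eq_cube field_simps)
  then have "(\<Sum>i\<in>{1..m}. \<Sum>j\<in>{1..m}. f i j) =
      (\<Sum>i\<in>{1..m}. \<Sum>j\<in>{1..m}. (1 + 3 * g i j + 3 * g i j ^ 2 + g i j ^ 3) / 8)"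
    by (intro sum.cong refl) blast
  then have "(\<Sum>i\<in>{1..m}. \<Sum>j\<in>{1..m}. f i j) =
      ((real m)\<^sup>2 + 3 * (\<Sum>i\<in>{1..m}. \<Sum>j\<in>{1..m}. g i j) + 3 * (\<Sum>i\<in>{1..m}. \<Sum>j\<in>{1..m}. g i j ^ 2)
        + (\<Sum>i\<in>{1..m}. \<Sum>j\<in>{1..m}. g i j ^ 3)) / 8"
    by (simp add: sum.distrib power2_eq_square[of "real m"] flip: sum_divide_distrib sum_distrib_left)
  ultimately show ?thesis
    unfolding g_def by simp
qed

lemma frame_potential_6_lower_bound:
  fixes v :: "nat \<Rightarrow> complex ^ 2"
  assumes "\<forall>i\<in>{1..m}. norm (v i) = 1"
  shows "real m * (real m - 4) / 8 \<le> frame_potential 6 m v"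
proof -
  have "(real m)\<^sup>2 / 3 \<le> (\<Sum>i\<in>{1..m}. \<Sum>j\<in>{1..m}. (hopf (v i) \<bullet> hopf (v j)) ^ 2)"
    using welch_bound[of "{1..m}" "\<lambda>i. hopf (v i)"] assms by (simp add: norm_hopf)
  then show ?thesis
    using sum_inner_nonneg[of "\<lambda>i. hopf (v i)" "{1..m}"]
      sum_inner_power3_nonneg[of "\<lambda>i. hopf (v i)" "{1..m}"]
    unfolding frame_potential_6_hopf[OF assms]
    by (simp add: power2_eq_square[of "real m"] field_simps)
qed

theorem theorem8:
  fixes m :: nat
  assumes "m \<ge> 6" and "even m"
  shows "(\<exists>v :: nat \<Rightarrow> real ^ 3.
      (\<forall>i\<in>{1..m}. v i \<in> sphere 0 1) \<and>
      (\<forall>w :: nat \<Rightarrow> real ^ 3. (\<forall>i\<in>{1..m}. w i \<in> sphere 0 1) \<longrightarrow>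
        (\<Sum>i\<in>{1..m}. \<Sum>j\<in>{1..m}. (v i \<bullet> v j) ^ 2) \<le> (\<Sum>i\<in>{1..m}. \<Sum>j\<in>{1..m}. (w i \<bullet> w j) ^ 2)) \<and>
      (\<Sum>i\<in>{1..m}. \<Sum>j\<in>{1..m}. v i \<bullet> v j) = 0 \<and>
      (\<Sum>i\<in>{1..m}. \<Sum>j\<in>{1..m}. (v i \<bullet> v j) ^ 3) = 0)
    \<and> min_potential 6 m TYPE(2) = real m * (real m - 4) / 8"
proof -
  obtain x :: "nat \<Rightarrow> real ^ 3" where norm_x: "\<And>i. norm (x i) = 1"
    and S1: "(\<Sum>i\<in>{1..m}. \<Sum>j\<in>{1..m}. x i \<bullet> x j) = 0"
    and S2: "(\<Sum>i\<in>{1..m}. \<Sum>j\<in>{1..m}. (x i \<bullet> x j) ^ 2) = (real m)\<^sup>2 / 3"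
    and S3: "(\<Sum>i\<in>{1..m}. \<Sum>j\<in>{1..m}. (x i \<bullet> x j) ^ 3) = 0"
    using exists_extremal_configuration[OF assms] by metis
  have "(real m)\<^sup>2 / 3 \<le> (\<Sum>i\<in>{1..m}. \<Sum>j\<in>{1..m}. (w i \<bullet> w j) ^ 2)"
    if "\<forall>i\<in>{1..m}. w i \<in> sphere 0 1" for w :: "nat \<Rightarrow> real ^ 3"
    using welch_bound[of "{1..m}" w] that by simp
  then have part_a: "\<forall>w :: nat \<Rightarrow> real ^ 3. (\<forall>i\<in>{1..m}. w i \<in> sphere 0 1) \<longrightarrow>
      (\<Sum>i\<in>{1..m}. \<Sum>j\<in>{1..m}. (x i \<bullet> x j) ^ 2) \<le> (\<Sum>i\<in>{1..m}. \<Sum>j\<in>{1..m}. (w i \<bullet> w j) ^ 2)"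
    unfolding S2 by blast
  have "\<forall>i. \<exists>v. norm v = 1 \<and> hopf v = x i"
    using hopf_surj[OF norm_x] by metis
  then obtain v where norm_v: "\<forall>i\<in>{1..m}. norm (v i) = 1" and hopf_v: "\<And>i. hopf (v i) = x i"
    by metis
  have "frame_potential 6 m v = real m * (real m - 4) / 8"
    unfolding frame_potential_6_hopf[OF norm_v] hopf_v S1 S2 S3
    by (simp add: power2_eq_square field_simps)
  then have "min_potential 6 m TYPE(2) = real m * (real m - 4) / 8"
    unfolding min_potential_def
    by (intro Least_equality) (use norm_v frame_potential_6_lower_bound in metis)+
  then show ?thesis
    using part_a S1 S3 norm_x by (intro conjI exI[of _ x]) simp_all
qed

end
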